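(* Let $(\overline{\mathfrak{p}};\overline{\mathfrak{q}})_{n}=(\mathfrak{p}_{1},\ldots,\mathfrak{p}_{n};\mathfrak{q}_{1},\ldots,\mathfrak{q}_{n})\in \mathcal{LMQB}_{n}$ and $(\overline{\mathfrak{l}};\overline{\mathfrak{s}})_{m}=(\mathfrak{l}_{1},\ldots,\mathfrak{l}_{m};\mathfrak{s}_{1},\ldots,\mathfrak{s}_{m})\in \mathcal{LMQB}_{m}$. For $k=1,\ldots,n-1$ let $(\overline{\mathfrak{p}};\overline{\mathfrak{q}})_{n}\circ_{k}(\overline{\mathfrak{l}};\overline{\mathfrak{s}})_{m}$ be the bi-vector whose first component is $$(\mathfrak{p}_{1},\ldots,\mathfrak{p}_{k-1},\ \mathfrak{l}_{1}-\mathfrak{s}_{1}(\mathfrak{p}_{k}+I),\ \mathfrak{l}_{2},\ldots,\mathfrak{l}_{m-1},\ \mathfrak{l}_{m}+I,\ \mathfrak{p}_{k+1}-\mathfrak{q}_{k+1},\ \mathfrak{p}_{k+2},\ldots,\mathfrak{p}_{n})$$ and whose second component is $$(\mathfrak{q}_{1},\ldots,\mathfrak{q}_{k-1},\ -\mathfrak{s}_{1}\mathfrak{q}_{k},\ \mathfrak{s}_{2},\ldots,\mathfrak{s}_{m},\ \mathfrak{q}_{k+1},\ldots,\mathfrak{q}_{n}),$$ and let $$(\overline{\mathfrak{p}};\overline{\mathfrak{q}})_{n}\circ_{n}(\overline{\mathfrak{l}};\overline{\mathfrak{s}})_{m}=(\mathfrak{p}_{1}-\mathfrak{q}_{1},\mathfrak{p}_{2},\ldots,\mathfrak{p}_{n-1},\mathfrak{l}_{1}-\mathfrak{s}_{1}(\mathfrak{p}_{n}+I),\mathfrak{l}_{2},\ldots,\mathfrak{l}_{m-1},\mathfrak{l}_{m}+I;\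 \mathfrak{q}_{1},\ldots,\mathfrak{q}_{n-1},-\mathfrak{s}_{1}\mathfrak{q}_{n},\mathfrak{s}_{2},\ldots,\mathfrak{s}_{m}).$$ Then $(\overline{\mathfrak{p}};\overline{\mathfrak{q}})_{n}\circ_{k}(\overline{\mathfrak{l}};\overline{\mathfrak{s}})_{m}\in \mathcal{LMQB}_{n+m-1}$ for $k=1,\ldots,n$.
   Context: Fix $l\ge 1$; all entries are $l\times l$ matrices (real or complex), $I$ and $O$ are the $l\times l$ identity and zero matrices. A bi-vector $(\mathfrak{p}_{1},\ldots,\mathfrak{p}_{n};\mathfrak{q}_{1},\ldots,\mathfrak{q}_{n})$ of $l\times l$ matrices is called a left matrix quiddity bi-sequence of length $n$ if $$\begin{pmatrix} \mathfrak{p}_{n} & \mathfrak{q}_{n}\\ I & O\end{pmatrix}\cdots\begin{pmatrix} \mathfrak{p}_{1} & \mathfrak{q}_{1}\\ I & O\end{pmatrix}=-\begin{pmatrix} I & O\\ O & I\end{pmatrix}.$$ $\mathcal{LMQB}_{n}$ is the set of all left matrix quiddity bi-sequences of length $n$. *)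

theory Defs
  imports Complex_Main "Jordan_Normal_Form.Matrix"
begin

(* "Real or complex entries" is rendered by the class real_normed_field: its norm is
   multiplicative, so by Mazur's theorem its instances are, up to isomorphism, exactly the
   real and the complex numbers. *)
type_synonym 'a bivec = "'a mat list \<times> 'a mat list"

definition quiddity_mat :: "nat \<Rightarrow> 'a::ring_1 mat \<Rightarrow> 'a mat \<Rightarrow> 'a mat" where
  "quiddity_mat l p q = four_block_mat p q (1\<^sub>m l) (0\<^sub>m l l)"

(* The factor with the largest index stands leftmost:
   fold f [x1, ..., xn] a = f xn (... (f x1 a)). *)
definition quiddity_prod :: "nat \<Rightarrow> 'a::ring_1 bivec \<Rightarrow> 'a mat" where
  "quiddity_prod l B =
     fold (\<lambda>(p, q) A. quiddity_mat l p q * A) (zip (fst B) (snd B)) (1\<^sub>m (l + l))"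

definition LMQB :: "nat \<Rightarrow> nat \<Rightarrow> 'a::ring_1 bivec set" where
  "LMQB l n =
     {(ps, qs). length ps = n \<and> length qs = n \<and>
        set ps \<subseteq> carrier_mat l l \<and> set qs \<subseteq> carrier_mat l l \<and>
        quiddity_prod l (ps, qs) =
          - four_block_mat (1\<^sub>m l) (0\<^sub>m l l) (0\<^sub>m l l) (1\<^sub>m l)}"

(* The index k counts from 1, whereas "!" counts from 0.  Only arguments in some LMQB l n and
   LMQB l m with 1 <= k <= n are of interest.  Then n, m >= 2 automatically if l >= 1 and 2 is
   not 0, so that the first and last entries of each list are at different positions. *)
definition circ :: "nat \<Rightarrow> nat \<Rightarrow> 'a::ring_1 bivec \<Rightarrow> 'a bivec \<Rightarrow> 'a bivec" where
  "circ l k = (\<lambda>(ps, qs) (ls, ss).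
     if k < length ps then
       (take (k - 1) ps
          @ [ls ! 0 - ss ! 0 * (ps ! (k - 1) + 1\<^sub>m l)]
          @ butlast (tl ls)
          @ [last ls + 1\<^sub>m l, ps ! k - qs ! k]
          @ drop (k + 1) ps,
        take (k - 1) qs
          @ [- (ss ! 0) * qs ! (k - 1)]
          @ tl ss
          @ drop k qs)
     else
       ([ps ! 0 - qs ! 0]
          @ butlast (tl ps)
          @ [ls ! 0 - ss ! 0 * (last ps + 1\<^sub>m l)]
          @ butlast (tl ls)
          @ [last ls + 1\<^sub>m l],
        butlast qs
          @ [- (ss ! 0) * last qs]
          @ tl ss))"

end

theory Submission
  imports Defs
begin

text \<open>
  Write \<open>M(p, q)\<close> for the factor of a quiddity product and put \<open>U = (I, I; O, I)\<close>,
  \<open>T = (I, O; I, I)\<close> and \<open>W(p, q) = (I, O; -(p + I), -q)\<close>.  The three kinds of altered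
  factors are \<open>M(p + I, q) = U M(p, q)\<close>, \<open>M(p - q, q) = M(p, q) T\<^sup>-\<^sup>1\<close> and
  \<open>M(a - s(p + I), -s q) = M(a, s) W(p, q)\<close>.  The inserted block therefore contributes
  \<open>U (-1) W(p, q)\<close>, which equals \<open>T M(p, q)\<close>.  If \<open>k < n\<close>, then \<open>T\<close> cancels against the \<open>T\<^sup>-\<^sup>1\<close>
  of the next factor; if \<open>k = n\<close>, the old product is conjugated by \<open>T\<close>, which fixes \<open>-1\<close>.
\<close>

subsection \<open>Quiddity products\<close>

lemma quiddity_mat_carrier [simp]:
  assumes "p \<in> carrier_mat l l" "q \<in> carrier_mat l l"
  shows "quiddity_mat l p q \<in> carrier_mat (l + l) (l + l)"
  using assms unfolding quiddity_mat_def by simp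

text \<open>The last list entry gives the outermost, leftmost factor, so induction from the right
  peels it off, and associativity moves the start value \<open>A\<close> to the far right. The
  dimension claim belongs to the same induction because associativity of \<open>mat\<close> products
  needs it.\<close>

lemma fold_quiddity_mat:
  fixes A :: "'a::ring_1 mat"
  assumes "set zs \<subseteq> carrier_mat l l \<times> carrier_mat l l" "A \<in> carrier_mat (l + l) (l + l)"
  defines "f \<equiv> \<lambda>(p, q) A. quiddity_mat l p q * A"
  shows "fold f zs (1\<^sub>m (l + l)) \<in> carrier_mat (l + l) (l + l) \<and>
    fold f zs A = fold f zs (1\<^sub>m (l + l)) * A"
  using assms(1,2)
proof (induction zs arbitrary: A rule: rev_induct)
  case (snoc z zs)
  obtain p q where z: "z = (p, q)" by force
  have Q: "quiddity_mat l p q \<in> carrier_mat (l + l) (l + l)"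
    using snoc.prems z by simp
  have F: "fold f zs (1\<^sub>m (l + l)) \<in> carrier_mat (l + l) (l + l)"
    and "fold f zs A = fold f zs (1\<^sub>m (l + l)) * A"
    using snoc.IH[of A] snoc.prems by simp_all
  moreover have "fold f (zs @ [z]) B = quiddity_mat l p q * fold f zs B" for B
    by (simp add: f_def z)
  ultimately show ?case
    using mult_carrier_mat[OF Q F] assoc_mult_mat[OF Q F snoc.prems(2)] by metis
qed auto

lemma set_zip_carrier:
  assumes "set ps \<subseteq> A" "set qs \<subseteq> B"
  shows "set (zip ps qs) \<subseteq> A \<times> B"
  using assms by (auto dest: set_zip_leftD set_zip_rightD)

lemma quiddity_prod_carrier [simp]:
  assumes "set ps \<subseteq> carrier_mat l l" "set qs \<subseteq> carrier_mat l l"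
  shows "quiddity_prod l (ps, qs) \<in> carrier_mat (l + l) (l + l)"
  using fold_quiddity_mat[OF set_zip_carrier[OF assms] one_carrier_mat]
  unfolding quiddity_prod_def by simp

lemma quiddity_prod_append:
  assumes "length ps = length qs"
    and "set ps \<subseteq> carrier_mat l l" "set qs \<subseteq> carrier_mat l l"
    and "set ps' \<subseteq> carrier_mat l l" "set qs' \<subseteq> carrier_mat l l"
  shows "quiddity_prod l (ps @ ps', qs @ qs') = quiddity_prod l (ps', qs') * quiddity_prod l (ps, qs)"
  using fold_quiddity_mat[OF set_zip_carrier[OF assms(4,5)] quiddity_prod_carrier[OF assms(2,3)]]
    assms(1)
  unfolding quiddity_prod_def by (simp add: zip_append)

lemma quiddity_prod_Nil [simp]: "quiddity_prod l ([], []) = 1\<^sub>m (l + l)"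
  unfolding quiddity_prod_def by simp

lemma quiddity_prod_Cons:
  assumes "p \<in> carrier_mat l l" "q \<in> carrier_mat l l"
    and "set ps \<subseteq> carrier_mat l l" "set qs \<subseteq> carrier_mat l l"
  shows "quiddity_prod l (p # ps, q # qs) = quiddity_prod l (ps, qs) * quiddity_mat l p q"
proof -
  have "quiddity_prod l ([p], [q]) = quiddity_mat l p q"
    using quiddity_mat_carrier[OF assms(1,2)] unfolding quiddity_prod_def by simp
  then show ?thesis
    using quiddity_prod_append[of "[p]" "[q]" l ps qs] assms by simp
qed

subsection \<open>Altered factors\<close>

definition upper_shear :: "nat \<Rightarrow> 'a::ring_1 mat" where
  "upper_shear l = four_block_mat (1\<^sub>m l) (1\<^sub>m l) (0\<^sub>m l l) (1\<^sub>m l)"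

definition lower_shear :: "nat \<Rightarrow> 'a::ring_1 mat" where
  "lower_shear l = four_block_mat (1\<^sub>m l) (0\<^sub>m l l) (1\<^sub>m l) (1\<^sub>m l)"

definition lower_shear_inv :: "nat \<Rightarrow> 'a::ring_1 mat" where
  "lower_shear_inv l = four_block_mat (1\<^sub>m l) (0\<^sub>m l l) (- 1\<^sub>m l) (1\<^sub>m l)"

text \<open>With U = \<open>upper_shear l\<close> and T = \<open>lower_shear l\<close>, this is the
  matrix W solving U (-1) W = T M(p, q), that is, minus the inverse of U times T M(p, q).\<close>

definition graft_mat :: "nat \<Rightarrow> 'a::ring_1 mat \<Rightarrow> 'a mat \<Rightarrow> 'a mat" where
  "graft_mat l p q = four_block_mat (1\<^sub>m l) (0\<^sub>m l l) (- (p + 1\<^sub>m l)) (- q)"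

lemma shear_carrier [simp]:
  "upper_shear l \<in> carrier_mat (l + l) (l + l)"
  "lower_shear l \<in> carrier_mat (l + l) (l + l)"
  "lower_shear_inv l \<in> carrier_mat (l + l) (l + l)"
  unfolding upper_shear_def lower_shear_def lower_shear_inv_def by simp_all

lemma graft_mat_carrier [simp]:
  assumes "p \<in> carrier_mat l l" "q \<in> carrier_mat l l"
  shows "graft_mat l p q \<in> carrier_mat (l + l) (l + l)"
  using assms unfolding graft_mat_def by simp

lemma four_block_one:
  "four_block_mat (1\<^sub>m l) (0\<^sub>m l l) (0\<^sub>m l l) (1\<^sub>m l) = (1\<^sub>m (l + l) :: 'a::ring_1 mat)"
  by (rule eq_matI) auto

lemma four_block_uminus:
  fixes A :: "'a::ring_1 mat"
  assumes "A \<in> carrier_mat l l" "B \<in> carrier_mat l l" "C \<in> carrier_mat l l" "D \<in> carrier_mat l l"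
  shows "- four_block_mat A B C D = four_block_mat (- A) (- B) (- C) (- D)"
  using assms by (intro eq_matI) auto

text \<open>The first identity serves the cancellation for \<open>k < n\<close>, the second the
  conjugation for \<open>k = n\<close>.\<close>

lemma lower_shear_inverse:
  "lower_shear_inv l * lower_shear l = (1\<^sub>m (l + l) :: 'a::ring_1 mat)"
  "lower_shear l * lower_shear_inv l = (1\<^sub>m (l + l) :: 'a::ring_1 mat)"
  unfolding lower_shear_def lower_shear_inv_def four_block_one[symmetric]
  by (subst mult_four_block_mat[where ?nr1.0=l and ?nr2.0=l and ?n1.0=l and ?n2.0=l
          and ?nc1.0=l and ?nc2.0=l];
      auto intro!: cong_four_block_mat eq_matI)+

text \<open>Left multiplication by U adds the lower block row (I, O) to the upper one.\<close>

lemma quiddity_mat_add_one: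
  assumes "p \<in> carrier_mat l l" "q \<in> carrier_mat l l"
  shows "quiddity_mat l (p + 1\<^sub>m l) q = upper_shear l * quiddity_mat l p q"
  unfolding quiddity_mat_def upper_shear_def using assms
  by (subst mult_four_block_mat[where ?nr1.0=l and ?nr2.0=l and ?n1.0=l and ?n2.0=l
          and ?nc1.0=l and ?nc2.0=l])
     (auto intro!: cong_four_block_mat)

text \<open>Right multiplication by the inverse of T subtracts the second block column from the
  first; the lower row (I, O) does not change.\<close>

lemma quiddity_mat_diff:
  assumes "p \<in> carrier_mat l l" "q \<in> carrier_mat l l"
  shows "quiddity_mat l (p - q) q = quiddity_mat l p q * lower_shear_inv l"
  unfolding quiddity_mat_def lower_shear_inv_def using assms
  by (subst mult_four_block_mat[where ?nr1.0=l and ?nr2.0=l and ?n1.0=l and ?n2.0=l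
          and ?nc1.0=l and ?nc2.0=l])
     (auto intro!: cong_four_block_mat simp: uminus_mult_right_mat minus_add_uminus_mat)

lemma quiddity_mat_graft:
  assumes "p \<in> carrier_mat l l" "q \<in> carrier_mat l l" "a \<in> carrier_mat l l" "s \<in> carrier_mat l l"
  shows "quiddity_mat l (a - s * (p + 1\<^sub>m l)) (- (s * q)) = quiddity_mat l a s * graft_mat l p q"
  unfolding quiddity_mat_def graft_mat_def using assms
  by (subst mult_four_block_mat[where ?nr1.0=l and ?nr2.0=l and ?n1.0=l and ?n2.0=l
          and ?nc1.0=l and ?nc2.0=l])
     (auto intro!: cong_four_block_mat simp: minus_add_uminus_mat[of _ l l])

text \<open>Both sides equal the block matrix (p, q; p + I, q).\<close>

lemma upper_shear_graft:
  assumes "p \<in> carrier_mat l l" "q \<in> carrier_mat l l"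
  shows "- (upper_shear l * graft_mat l p q) = lower_shear l * quiddity_mat l p q"
  unfolding quiddity_mat_def graft_mat_def upper_shear_def lower_shear_def using assms
  by (subst (1 2) mult_four_block_mat[where ?nr1.0=l and ?nr2.0=l and ?n1.0=l and ?n2.0=l
          and ?nc1.0=l and ?nc2.0=l])
     (auto intro!: cong_four_block_mat eq_matI simp: four_block_uminus)

subsection \<open>Bi-sequences\<close>

lemma LMQB_iff:
  "(ps, qs) \<in> LMQB l n \<longleftrightarrow> length ps = n \<and> length qs = n \<and>
     set ps \<subseteq> carrier_mat l l \<and> set qs \<subseteq> carrier_mat l l \<and>
     quiddity_prod l (ps, qs) = - 1\<^sub>m (l + l)"
  unfolding LMQB_def four_block_one by simp

text \<open>The empty product is 1, which differs from -1 in characteristic 0. A single factor has I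
  in its lower left block, where -1 has O. The bound makes the first and last entries of each list
  distinct positions.\<close>

lemma LMQB_length_ge_2:
  fixes ps qs :: "'a::{ring_1, ring_char_0} mat list"
  assumes "(ps, qs) \<in> LMQB l n" "l \<ge> 1"
  shows "n \<ge> 2"
proof (rule ccontr)
  assume "\<not> n \<ge> 2"
  then consider "n = 0" | "n = 1" by linarith
  then show False
  proof cases
    case 1
    then have "1\<^sub>m (l + l) = (- 1\<^sub>m (l + l) :: 'a mat)"
      using assms unfolding LMQB_iff by auto
    then have "1\<^sub>m (l + l) $$ (0, 0) = (- 1\<^sub>m (l + l) :: 'a mat) $$ (0, 0)"
      by (rule arg_cong)
    then show False using assms(2) by simp
  next
    case 2
    then obtain p q where pq: "ps = [p]" "qs = [q]"
      using assms(1) unfolding LMQB_iff by (auto simp: length_Suc_conv)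
    then have c: "p \<in> carrier_mat l l" "q \<in> carrier_mat l l"
      and "quiddity_mat l p q = - 1\<^sub>m (l + l)"
      using assms(1) unfolding LMQB_iff
      by (auto simp: quiddity_prod_Cons left_mult_one_mat[of _ "l + l" "l + l"])
    \<comment> \<open>Position \<open>(l, 0)\<close> is the top left corner of the lower left
      block.\<close>
    then have "quiddity_mat l p q $$ (l, 0) = (- 1\<^sub>m (l + l) :: 'a mat) $$ (l, 0)"
      by simp
    then show False using assms(2) c unfolding quiddity_mat_def by simp
  qed
qed

lemma list_first_last:
  assumes "length xs \<ge> 2"
  obtains a ys b where "xs = a # ys @ [b]" "length ys = length xs - 2"
  using assms by (cases xs; cases "tl xs" rule: rev_cases) auto

text \<open>Changing the last factor puts U on the left of the old product, and changing the first
  puts W on its right. The old product between them is -1. The pair \<open>p\<close>,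
  \<open>q\<close> stays arbitrary so that both \<open>k < n\<close> and \<open>k = n\<close> can
  use the result.\<close>

lemma quiddity_prod_graft:
  fixes p q a b s t :: "'a::ring_1 mat"
  assumes "(a # ls @ [b], s # ss @ [t]) \<in> LMQB l m"
    and "p \<in> carrier_mat l l" "q \<in> carrier_mat l l"
  shows "quiddity_prod l ((a - s * (p + 1\<^sub>m l)) # ls @ [b + 1\<^sub>m l], (- (s * q)) # ss @ [t]) =
    lower_shear l * quiddity_mat l p q"
proof -
  let ?N = "l + l"
  have c: "a \<in> carrier_mat l l" "b \<in> carrier_mat l l" "s \<in> carrier_mat l l" "t \<in> carrier_mat l l"
    "set ls \<subseteq> carrier_mat l l" "set ss \<subseteq> carrier_mat l l" and len: "length ls = length ss"
    and prod: "quiddity_prod l (a # ls @ [b], s # ss @ [t]) = - 1\<^sub>m ?N"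
    using assms(1) unfolding LMQB_iff by auto
  define B where "B = quiddity_mat l b t"
  define E where "E = quiddity_prod l (ls, ss)"
  define A where "A = quiddity_mat l a s"
  define U :: "'a mat" where "U = upper_shear l"
  define W where "W = graft_mat l p q"
  have C: "B \<in> carrier_mat ?N ?N" "E \<in> carrier_mat ?N ?N" "A \<in> carrier_mat ?N ?N"
    "U \<in> carrier_mat ?N ?N" "W \<in> carrier_mat ?N ?N"
    unfolding A_def B_def E_def U_def W_def using c assms by auto
  note mult_rules = assoc_mult_mat[of _ ?N ?N _ ?N _ ?N] mult_carrier_mat[of _ ?N ?N _ ?N]
  have BEA: "B * E * A = - 1\<^sub>m ?N"
    using prod c len left_mult_one_mat[of B ?N ?N] C by (simp add: A_def B_def E_def
        quiddity_prod_Cons quiddity_prod_append)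
  have c': "a - s * (p + 1\<^sub>m l) \<in> carrier_mat l l" "- (s * q) \<in> carrier_mat l l"
    using c assms(2,3) by (auto intro!: minus_carrier_mat)
  \<comment> \<open>Unfolding the list down to its empty tail leaves this unit matrix on the
    left.\<close>
  have "1\<^sub>m ?N * (U * B) = U * B"
    using C by (intro left_mult_one_mat[of _ ?N ?N]) simp
  then have "quiddity_prod l ((a - s * (p + 1\<^sub>m l)) # ls @ [b + 1\<^sub>m l], (- (s * q)) # ss @ [t]) =
      U * B * E * (A * W)"
    using c c' len assms(2,3)
    by (simp add: A_def B_def E_def U_def W_def quiddity_prod_Cons quiddity_prod_append
        quiddity_mat_add_one quiddity_mat_graft)
  also have "\<dots> = U * (B * E * A * W)"
    using C by (simp add: mult_rules)
  also have "\<dots> = - (U * W)"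
    using C unfolding BEA by simp
  finally show ?thesis
    using upper_shear_graft[OF assms(2,3)] by (simp add: U_def W_def)
qed

theorem theorem32:
  fixes P L :: "'a::real_normed_field bivec" and l n m k :: nat
  assumes "l \<ge> 1"
    and "P \<in> LMQB l n"
    and "L \<in> LMQB l m"
    and "k \<in> {1..n}"
  shows "circ l k P L \<in> LMQB l (n + m - 1)"
proof -
  let ?N = "l + l"
  note mult_rules = assoc_mult_mat[of _ ?N ?N _ ?N _ ?N] mult_carrier_mat[of _ ?N ?N _ ?N]
  obtain ps qs where P: "P = (ps, qs)" by force
  obtain ls ss where L: "L = (ls, ss)" by force
  have n2: "n \<ge> 2" and m2: "m \<ge> 2"
    using LMQB_length_ge_2 assms(1-3) P L by blast+
  have lenP: "length ps = n" "length qs = n"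
    and cP: "set ps \<subseteq> carrier_mat l l" "set qs \<subseteq> carrier_mat l l"
    and prodP: "quiddity_prod l (ps, qs) = - 1\<^sub>m ?N"
    using assms(2) unfolding P LMQB_iff by auto
  have lenL: "length ls = m" "length ss = m"
    and cL: "set ls \<subseteq> carrier_mat l l" "set ss \<subseteq> carrier_mat l l"
    using assms(3) unfolding L LMQB_iff by auto
  obtain a lm b where ls: "ls = a # lm @ [b]" and lm: "length lm = m - 2"
    using list_first_last[of ls] m2 lenL by metis
  obtain s sm t where ss: "ss = s # sm @ [t]" and sm: "length sm = m - 2"
    using list_first_last[of ss] m2 lenL by metis
  have T: "lower_shear l \<in> carrier_mat ?N ?N" "lower_shear_inv l \<in> carrier_mat ?N ?N"
    by simp_all
  show ?thesis
  proof (cases "k < n")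
    case True
    \<comment> \<open>In positions counted from 0, the entry at \<open>i\<close> is replaced by the
      block, and the entry at \<open>Suc i\<close>, which is \<open>k\<close>, becomes
      \<open>x - y\<close>.\<close>
    define i where "i = k - 1"
    have k: "k = Suc i" and i: "Suc i < n" using assms(4) True by (auto simp: i_def)
    define p1 p2 p3 where "p1 = take i ps" and "p2 = ps ! i" and "p3 = drop (Suc (Suc i)) ps"
    define q1 q2 q3 where "q1 = take i qs" and "q2 = qs ! i" and "q3 = drop (Suc (Suc i)) qs"
    define x y where "x = ps ! Suc i" and "y = qs ! Suc i"
    have ps: "ps = p1 @ p2 # x # p3" and qs: "qs = q1 @ q2 # y # q3"
      using i lenP by (simp_all add: p1_def p2_def p3_def q1_def q2_def q3_def x_def y_def
          Cons_nth_drop_Suc flip: id_take_nth_drop)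
    have len1: "length p1 = i" "length q1 = i" using i lenP by (simp_all add: p1_def q1_def)
    have len3: "length p3 = n - i - 2" "length q3 = n - i - 2"
      using i lenP by (simp_all add: p3_def q3_def)
    have c: "set p1 \<subseteq> carrier_mat l l" "set q1 \<subseteq> carrier_mat l l"
      "set p3 \<subseteq> carrier_mat l l" "set q3 \<subseteq> carrier_mat l l"
      "p2 \<in> carrier_mat l l" "q2 \<in> carrier_mat l l" "x \<in> carrier_mat l l" "y \<in> carrier_mat l l"
      "set lm \<subseteq> carrier_mat l l" "set sm \<subseteq> carrier_mat l l"
      "a \<in> carrier_mat l l" "b \<in> carrier_mat l l" "s \<in> carrier_mat l l" "t \<in> carrier_mat l l"
      using cP cL unfolding ps qs ls ss by auto
    define G where "G = (a - s * (p2 + 1\<^sub>m l)) # lm @ [b + 1\<^sub>m l]"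
    define H where "H = (- (s * q2)) # sm @ [t]"
    have cGH: "set G \<subseteq> carrier_mat l l" "set H \<subseteq> carrier_mat l l" "length G = length H"
      unfolding G_def H_def using c lm sm by auto
    \<comment> \<open>\<open>circ\<close> writes the altered second component as
      \<open>(- s) * q2\<close>, while \<open>H\<close> has \<open>- (s * q2)\<close>; the carrier
      facts in \<open>c\<close> let the sign move out.\<close>
    have circ: "circ l k P L = (p1 @ G @ (x - y) # p3, q1 @ H @ y # q3)"
      using lenP len1 i c unfolding circ_def P L k G_def H_def
      by (simp add: ps qs ls ss nth_append)
    define A D E K where "A = quiddity_prod l (p1, q1)" and "D = quiddity_prod l (p3, q3)"
      and "E = quiddity_mat l x y" and "K = quiddity_mat l p2 q2"
    have C: "A \<in> carrier_mat ?N ?N" "D \<in> carrier_mat ?N ?N" "E \<in> carrier_mat ?N ?N"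
      "K \<in> carrier_mat ?N ?N"
      unfolding A_def D_def E_def K_def using c by auto
    have xy: "x - y \<in> carrier_mat l l"
      using c by (intro minus_carrier_mat)
    have "quiddity_prod l (circ l k P L) =
        D * (E * lower_shear_inv l) * (lower_shear l * K) * A"
      using c xy cGH len1 quiddity_prod_graft[OF assms(3)[unfolded L ls ss], of p2 q2]
      unfolding circ
      by (simp add: quiddity_prod_append quiddity_prod_Cons quiddity_mat_diff
          A_def D_def E_def K_def flip: G_def H_def)
    \<comment> \<open>The factor of \<open>x - y\<close> stands directly to the left of the block's
      product, so the two shears meet and cancel.\<close>
    also have "\<dots> = D * (E * ((lower_shear_inv l * lower_shear l) * (K * A)))"
      using C by (simp add: mult_rules)
    also have "\<dots> = D * E * K * A"
      using C unfolding lower_shear_inverse by (simp add: mult_rules)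
    also have "\<dots> = quiddity_prod l (ps, qs)"
      using c len1 by (simp add: ps qs quiddity_prod_append quiddity_prod_Cons
          A_def D_def E_def K_def)
    finally have "quiddity_prod l (circ l k P L) = - 1\<^sub>m ?N"
      using prodP by simp
    \<comment> \<open>The lengths add up to i + m + 1 + (n - i - 2) = n + m - 1.\<close>
    then show ?thesis
      using c xy cGH len1 len3 lm sm i m2 unfolding circ LMQB_iff by (auto simp: G_def H_def)
  next
    case False
    \<comment> \<open>Here \<open>k = n\<close>, and the entry cyclically after the replaced one is
      the first, \<open>x\<close>.\<close>
    obtain x pm p where ps: "ps = x # pm @ [p]" and pm: "length pm = n - 2"
      using list_first_last[of ps] n2 lenP by metis
    obtain y qm q where qs: "qs = y # qm @ [q]" and qm: "length qm = n - 2"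
      using list_first_last[of qs] n2 lenP by metis
    have c: "set pm \<subseteq> carrier_mat l l" "set qm \<subseteq> carrier_mat l l"
      "p \<in> carrier_mat l l" "q \<in> carrier_mat l l" "x \<in> carrier_mat l l" "y \<in> carrier_mat l l"
      "set lm \<subseteq> carrier_mat l l" "set sm \<subseteq> carrier_mat l l"
      "a \<in> carrier_mat l l" "b \<in> carrier_mat l l" "s \<in> carrier_mat l l" "t \<in> carrier_mat l l"
      using cP cL unfolding ps qs ls ss by auto
    define G where "G = (a - s * (p + 1\<^sub>m l)) # lm @ [b + 1\<^sub>m l]"
    define H where "H = (- (s * q)) # sm @ [t]"
    have cGH: "set G \<subseteq> carrier_mat l l" "set H \<subseteq> carrier_mat l l" "length G = length H"
      unfolding G_def H_def using c lm sm by auto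
    have circ: "circ l k P L = ((x - y) # pm @ G, y # qm @ H)"
      using lenP False c unfolding circ_def P L G_def H_def
      by (simp add: ps qs ls ss butlast_append)
    define E D K where "E = quiddity_mat l x y" and "D = quiddity_prod l (pm, qm)"
      and "K = quiddity_mat l p q"
    have C: "D \<in> carrier_mat ?N ?N" "E \<in> carrier_mat ?N ?N" "K \<in> carrier_mat ?N ?N"
      unfolding D_def E_def K_def using c by auto
    have KDE: "K * D * E = - 1\<^sub>m ?N"
      using c pm qm prodP left_mult_one_mat[of K ?N ?N] C
      by (simp add: ps qs quiddity_prod_append quiddity_prod_Cons D_def E_def K_def)
    have xy: "x - y \<in> carrier_mat l l"
      using c by (intro minus_carrier_mat)
    \<comment> \<open>The shears now stand at opposite ends of the product \<open>K * D * E\<close>,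
      which is -1 and hence commutes with them.\<close>
    have "quiddity_prod l (circ l k P L) = lower_shear l * K * D * (E * lower_shear_inv l)"
      using c xy cGH pm qm quiddity_prod_graft[OF assms(3)[unfolded L ls ss], of p q]
      unfolding circ
      by (simp add: quiddity_prod_append quiddity_prod_Cons quiddity_mat_diff
          D_def E_def K_def flip: G_def H_def)
    also have "\<dots> = lower_shear l * (K * D * E * lower_shear_inv l)"
      using C by (simp add: mult_rules)
    also have "\<dots> = - (lower_shear l * lower_shear_inv l)"
      unfolding KDE by (simp add: carrier_matD[OF T(1)] carrier_matD[OF T(2)])
    finally have "quiddity_prod l (circ l k P L) = - 1\<^sub>m ?N"
      unfolding lower_shear_inverse .
    then show ?thesis
      using c xy cGH pm qm lm sm n2 m2 unfolding circ LMQB_iff by (auto simp: G_def H_def)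
  qed
qed

end
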